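(* Let $\omega\in\mathbb{R}^d$ be nonresonant and $t_0\in\mathbb{R}$. Let $\bar\beta(t_0)=\left.\frac{d}{dt}\bar\alpha(t;t_0)\right|_{t=t_0}\in\mathbb{C}^{\mathcal{W}}$, where $\bar\alpha(t;t_0)=\Gamma(t-t_0,t_0\omega;t_0\omega)$ and $\Gamma$ is defined by the recursions in the context. Given $r\geq 1$, $\mathbf{k}\in \mathbb{Z}^d\setminus\{\mathbf{0}\}$, $s\ge1$ and $\mathbf{l}_1,\ldots,\mathbf{l}_s \in \mathbb{Z}^d$, $$\bar \beta_{\mathbf{k}}(t_0)= 0,\qquad \bar \beta_{\mathbf{0}}(t_0) = 1,\qquad \bar \beta_{\mathbf{0}^{r+1}}(t_0) = 0,$$ $$\bar \beta_{\mathbf{0}^r \mathbf{k}}(t_0) = \frac{i}{\mathbf{k}\cdot \omega}\big( \bar\beta_{ \mathbf{0}^{r-1}\mathbf{k}}(t_0) - \bar \beta_{\mathbf{0}^{r}}(t_0)e^{i\mathbf{k}\cdot \omega t_0}\big),$$ $$\bar \beta_{\mathbf{k} \mathbf{l}_1\cdots \mathbf{l}_s}(t_0) = \frac{i}{\mathbf{k}\cdot \omega}\big(e^{i\mathbf{k}\cdot \omega t_0}\bar \beta_{\mathbf{l}_1\cdots \mathbf{l}_s}(t_0)- \bar \beta_{(\mathbf{k}+\mathbf{l}_1) \mathbf{l}_2\cdots \mathbf{l}_s}(t_0)\big),$$ $$\bar \beta_{\mathbf{0}^r \mathbf{k} \mathbf{l}_1\cdots \mathbf{l}_s}(t_0)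 = \frac{i}{\mathbf{k}\cdot \omega}\big(\bar \beta_{\mathbf{0}^{r-1} \mathbf{k} \mathbf{l}_1\cdots \mathbf{l}_s}(t_0) - \bar \beta_{\mathbf{0}^{r} (\mathbf{k}+\mathbf{l}_1) \mathbf{l}_2\cdots \mathbf{l}_s}(t_0)\big).$$
   Context: $\mathbb{T}^d=(\mathbb{R}/2\pi\mathbb{Z})^d$. $\mathcal{W}$ is the set of all words (including the empty word $\emptyset$) with letters in the alphabet $\mathbb{Z}^d$, and $\mathbb{C}^{\mathcal{W}}$ is the vector space of all maps $\delta:\mathcal{W}\to\mathbb{C}$, $w\mapsto\delta_w$. Derivatives in $\mathbb{C}^{\mathcal{W}}$ are taken word by word. $\mathbf{0}^r$ is the word consisting of $r$ letters $\mathbf{0}$ ($\mathbf{0}^0$ is empty), and $(\mathbf{k}+\mathbf{l}_1)$ is a single letter, the sum in $\mathbb{Z}^d$. A vector $\omega\in\mathbb{R}^d$ is nonresonant if $\mathbf{k}\cdot\omega\neq 0$ for every $\mathbf{k}\in\mathbb{Z}^d\setminus\{\mathbf{0}\}$. Definition of $\Gamma(\tau,\theta;\theta_0)\in\mathbb{C}^{\mathcal{W}}$, $\tau\in\mathbb{R}$, $\theta,\theta_0\in\mathbb{T}^d$ (arguments omitted where unambiguous): $\Gamma_\emptyset=1$ and, for $r\ge1$, $\mathbf{k}\in\mathbb{Z}^d\setminus\{\mathbf{0}\}$, $s\ge1$, $\mathbf{l}_1,\dots,\mathbf{l}_s\in\mathbb{Z}^d$: $\Gamma_{\mathbf{k}}=\frac{i}{\mathbf{k}\cdot\omega}(e^{i\mathbf{k}\cdot\theta_0}-e^{i\mathbf{k}\cdot\theta})$;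 $\Gamma_{\mathbf{0}^r}=\tau^r/r!$; $\Gamma_{\mathbf{0}^r\mathbf{k}}=\frac{i}{\mathbf{k}\cdot\omega}(\Gamma_{\mathbf{0}^{r-1}\mathbf{k}}-\Gamma_{\mathbf{0}^r}e^{i\mathbf{k}\cdot\theta})$; $\Gamma_{\mathbf{k}\mathbf{l}_1\cdots\mathbf{l}_s}=\frac{i}{\mathbf{k}\cdot\omega}(e^{i\mathbf{k}\cdot\theta_0}\Gamma_{\mathbf{l}_1\cdots\mathbf{l}_s}-\Gamma_{(\mathbf{k}+\mathbf{l}_1)\mathbf{l}_2\cdots\mathbf{l}_s})$; $\Gamma_{\mathbf{0}^r\mathbf{k}\mathbf{l}_1\cdots\mathbf{l}_s}=\frac{i}{\mathbf{k}\cdot\omega}(\Gamma_{\mathbf{0}^{r-1}\mathbf{k}\mathbf{l}_1\cdots\mathbf{l}_s}-\Gamma_{\mathbf{0}^r(\mathbf{k}+\mathbf{l}_1)\mathbf{l}_2\cdots\mathbf{l}_s})$. *)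

theory Defs
  imports "HOL-Analysis.Analysis"
begin

text \<open>
  Letters are elements of \<open>int ^ 'd\<close>, words are lists of letters, and \<open>\<complex>\<^sup>\<W>\<close> is the function type
  \<open>(int ^ 'd) list \<Rightarrow> complex\<close>. Points of the torus are represented by lifts in \<open>real ^ 'd\<close>;
  \<open>Gam_periodic\<close> below shows that \<open>Gam\<close> descends to the torus in both angular arguments.
\<close>

definition ldot :: "int ^ 'd \<Rightarrow> real ^ 'd \<Rightarrow> real" (infix \<open>\<odot>\<close> 75)
  where "k \<odot> v = (\<Sum>j\<in>UNIV. real_of_int (k $ j) * v $ j)"

definition nonresonant :: "real ^ 'd \<Rightarrow> bool"
  where "nonresonant \<omega> \<longleftrightarrow> (\<forall>k :: int ^ 'd. k \<noteq> 0 \<longrightarrow> k \<odot> \<omega> \<noteq> 0)"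

definition strip :: "'a \<Rightarrow> 'a list \<Rightarrow> nat \<times> 'a list"
  where "strip z w = (length (takeWhile (\<lambda>x. x = z) w), dropWhile (\<lambda>x. x = z) w)"

lemma strip_simps:
  "strip z [] = (0, [])"
  "strip z (replicate r z) = (r, [])"
  "k \<noteq> z \<Longrightarrow> strip z (k # u) = (0, k # u)"
  "k \<noteq> z \<Longrightarrow> strip z (replicate r z @ k # u) = (r, k # u)"
proof -
  show "strip z [] = (0, [])" "k \<noteq> z \<Longrightarrow> strip z (k # u) = (0, k # u)"
    by (simp_all add: strip_def)
  show "strip z (replicate r z) = (r, [])"
    by (induction r) (auto simp: strip_def)
  show "k \<noteq> z \<Longrightarrow> strip z (replicate r z @ k # u) = (r, k # u)"
    by (induction r) (auto simp: strip_def)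
qed

lemma word_split:
  "(\<exists>r. w = replicate r z) \<or> (\<exists>r k u. k \<noteq> z \<and> w = replicate r z @ k # u)"
proof (induction w)
  case Nil
  then show ?case by (metis replicate_0)
next
  case (Cons a w)
  show ?case
  proof (cases "a = z")
    case True
    with Cons.IH show ?thesis
      by (metis append_Cons replicate_Suc)
  next
    case False
    then show ?thesis by (metis append_Nil replicate_0)
  qed
qed

function Gam :: "real ^ 'd \<Rightarrow> real \<Rightarrow> real ^ 'd \<Rightarrow> real ^ 'd \<Rightarrow> (int ^ 'd) list \<Rightarrow> complex" where
  "Gam \<omega> \<tau> \<theta> \<theta>0 [] = 1"
| "k \<noteq> 0 \<Longrightarrow> Gam \<omega> \<tau> \<theta> \<theta>0 [k] =
     \<i> / of_real (k \<odot> \<omega>) * (exp (\<i> * of_real (k \<odot> \<theta>0)) - exp (\<i> * of_real (k \<odot> \<theta>)))"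
| "r \<ge> 1 \<Longrightarrow> Gam \<omega> \<tau> \<theta> \<theta>0 (replicate r 0) = of_real (\<tau> ^ r / fact r)"
| "r \<ge> 1 \<Longrightarrow> k \<noteq> 0 \<Longrightarrow> Gam \<omega> \<tau> \<theta> \<theta>0 (replicate r 0 @ [k]) =
     \<i> / of_real (k \<odot> \<omega>) *
       (Gam \<omega> \<tau> \<theta> \<theta>0 (replicate (r - 1) 0 @ [k])
        - Gam \<omega> \<tau> \<theta> \<theta>0 (replicate r 0) * exp (\<i> * of_real (k \<odot> \<theta>)))"
| "k \<noteq> 0 \<Longrightarrow> Gam \<omega> \<tau> \<theta> \<theta>0 (k # l # ls) =
     \<i> / of_real (k \<odot> \<omega>) *
       (exp (\<i> * of_real (k \<odot> \<theta>0)) * Gam \<omega> \<tau> \<theta> \<theta>0 (l # ls)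
        - Gam \<omega> \<tau> \<theta> \<theta>0 ((k + l) # ls))"
| "r \<ge> 1 \<Longrightarrow> k \<noteq> 0 \<Longrightarrow> Gam \<omega> \<tau> \<theta> \<theta>0 (replicate r 0 @ k # l # ls) =
     \<i> / of_real (k \<odot> \<omega>) *
       (Gam \<omega> \<tau> \<theta> \<theta>0 (replicate (r - 1) 0 @ k # l # ls)
        - Gam \<omega> \<tau> \<theta> \<theta>0 (replicate r 0 @ (k + l) # ls))"
proof goal_cases
  case (1 P x)
  obtain \<omega> \<tau> \<theta> \<theta>0 w where x: "x = (\<omega>, \<tau>, \<theta>, \<theta>0, w)" by (metis prod.exhaust)
  from word_split[of w 0] show P
  proof (elim disjE exE conjE)
    fix r assume w: "w = replicate r 0"
    show P
    proof (cases "r = 0")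
      case True
      with w x show P by (intro 1(1)) simp
    next
      case False
      with w x show P by (intro 1(3)) simp_all
    qed
  next
    fix r k u assume k: "k \<noteq> 0" and w: "w = replicate r 0 @ k # u"
    show P
    proof (cases "r = 0")
      case True
      show P
      proof (cases u)
        case Nil
        with k w x True show P by (intro 1(2)) simp_all
      next
        case (Cons l ls)
        with k w x True show P by (intro 1(5)) simp_all
      qed
    next
      case False
      show P
      proof (cases u)
        case Nil
        with k w x False show P by (intro 1(4)) simp_all
      next
        case (Cons l ls)
        with k w x False show P by (intro 1(6)) simp_all
      qed
    qed
  qed
qed (elim Pair_inject, drule arg_cong[where f = "strip 0"], simp add: strip_simps; fail)+
termination
  by (relation "Wellfounded.measure (\<lambda>(\<omega>, \<tau>, \<theta>, \<theta>0, w). length w)") auto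

lemma ldot_shift:
  "exp (\<i> * of_real (k \<odot> (\<theta> + (\<chi> j. 2 * pi * real_of_int (m $ j))))) = exp (\<i> * of_real (k \<odot> \<theta>))"
proof -
  have "k \<odot> (\<theta> + (\<chi> j. 2 * pi * real_of_int (m $ j)))
      = k \<odot> \<theta> + 2 * pi * real_of_int (\<Sum>j\<in>UNIV. k $ j * m $ j)"
    by (simp add: ldot_def algebra_simps sum.distrib sum_distrib_left)
  then show ?thesis
    unfolding exp_eq by (auto simp: algebra_simps intro!: exI[of _ "\<Sum>j\<in>UNIV. k $ j * m $ j"])
qed

lemma Gam_periodic:
  "Gam \<omega> \<tau> (\<theta> + (\<chi> j. 2 * pi * real_of_int (m $ j)))
     (\<theta>0 + (\<chi> j. 2 * pi * real_of_int (n $ j))) w = Gam \<omega> \<tau> \<theta> \<theta>0 w"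
  by (induction \<omega> \<tau> \<theta> \<theta>0 w rule: Gam.induct) (simp_all add: ldot_shift)

definition alpha_bar :: "real ^ 'd \<Rightarrow> real \<Rightarrow> real \<Rightarrow> (int ^ 'd) list \<Rightarrow> complex"
  where "alpha_bar \<omega> t t0 = Gam \<omega> (t - t0) (t0 *\<^sub>R \<omega>) (t0 *\<^sub>R \<omega>)"

definition beta_bar :: "real ^ 'd \<Rightarrow> real \<Rightarrow> (int ^ 'd) list \<Rightarrow> complex"
  where "beta_bar \<omega> t0 w = vector_derivative (\<lambda>t. alpha_bar \<omega> t t0 w) (at t0)"

lemma Gam_differentiable: "(\<lambda>\<tau>. Gam \<omega> \<tau> \<theta> \<theta>0 w) differentiable (at x)"
proof -
  have pow: "(\<lambda>\<tau>. complex_of_real (\<tau> ^ r / fact r)) differentiable (at x)" for r x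
    by simp
  show ?thesis
    by (induction \<omega> x \<theta> \<theta>0 w rule: Gam.induct)
       (simp_all only: Gam.simps pow differentiable_diff differentiable_mult differentiable_const
         not_False_eq_True)
qed

text \<open>The derivative defining \<open>beta_bar\<close> exists for every word.\<close>

lemma alpha_bar_has_vector_derivative:
  "((\<lambda>t. alpha_bar \<omega> t t0 w) has_vector_derivative beta_bar \<omega> t0 w) (at t0)"
proof -
  have "((\<lambda>\<tau>. Gam \<omega> \<tau> (t0 *\<^sub>R \<omega>) (t0 *\<^sub>R \<omega>) w) \<circ> (\<lambda>t. t - t0)) differentiable (at t0)"
    by (rule differentiable_chain_at) (auto intro: Gam_differentiable)
  then show ?thesis
    unfolding beta_bar_def alpha_bar_def by (simp add: o_def vector_derivative_works[symmetric])
qed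

end

theory Submission
  imports Defs
begin

text \<open>
  The point \<open>\<theta> = \<theta>0 = t0 *\<^sub>R \<omega>\<close> is held fixed when \<open>alpha_bar \<omega> t t0\<close> is differentiated in
  \<open>t\<close>: time enters only through \<open>\<tau> = t - t0\<close>, hence only through the values \<open>\<tau> ^ r / r!\<close> on the words
  \<open>replicate r 0\<close>. All other recursions for \<open>Gam\<close> express its value on one word as a linear combination
  of its values on at most two other words, with coefficients that do not depend on \<open>\<tau>\<close>. Differentiation
  is linear, so \<open>beta_bar\<close> satisfies the same recursions (lemma \<open>beta_bar_lincomb\<close>), with
  \<open>exp (\<i> k \<odot> \<theta>)\<close> and \<open>exp (\<i> k \<odot> \<theta>0)\<close> both equal to
  \<open>exp (\<i> (k \<odot> \<omega>) t0)\<close>. The inhomogeneous data come from differentiating at \<open>\<tau> = 0\<close>: the monomials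
  \<open>\<tau> ^ r / r!\<close> have derivative \<open>1\<close> for \<open>r = 1\<close> and \<open>0\<close> for \<open>r > 1\<close>
  (lemma \<open>beta_bar_replicate_zero\<close>), and the values on the words \<open>[k]\<close> with \<open>k \<noteq> 0\<close> do not
  depend on \<open>\<tau>\<close> at all.
\<close>

lemma ldot_scaleR: "k \<odot> (c *\<^sub>R v) = k \<odot> v * c"
  by (simp add: ldot_def sum_distrib_left mult_ac)

lemma beta_bar_eqI:
  assumes "((\<lambda>t. alpha_bar \<omega> t t0 w) has_vector_derivative D) (at t0)"
  shows "beta_bar \<omega> t0 w = D"
  using assms unfolding beta_bar_def by (rule vector_derivative_at)

text \<open>
  Linearity of the derivative, in the shape of the recursions: each of them is an instance with one of the
  two coefficients \<open>a\<close>, \<open>b\<close> equal to \<open>1\<close>, or with both equal to \<open>1\<close>.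
\<close>

lemma beta_bar_lincomb:
  assumes "\<And>t. alpha_bar \<omega> t t0 w = c * (a * alpha_bar \<omega> t t0 u - alpha_bar \<omega> t t0 v * b)"
  shows "beta_bar \<omega> t0 w = c * (a * beta_bar \<omega> t0 u - beta_bar \<omega> t0 v * b)"
  by (rule beta_bar_eqI, subst assms)
     (intro has_vector_derivative_mult_right has_vector_derivative_mult_left
        has_vector_derivative_diff alpha_bar_has_vector_derivative)

text \<open>
  The derivative of \<open>\<tau> ^ r / r!\<close> is \<open>\<tau> ^ (r - 1) / (r - 1)!\<close>; at \<open>\<tau> = 0\<close> only the
  power \<open>\<tau> ^ 0 = 1\<close> survives.
\<close>

lemma beta_bar_replicate_zero:
  assumes "r \<ge> 1"
  shows "beta_bar \<omega> t0 (replicate r 0) = (if r = 1 then 1 else 0)"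
proof (rule beta_bar_eqI)
  have "((\<lambda>t. (t - t0) ^ r / fact r) has_real_derivative (if r = 1 then 1 else 0)) (at t0)"
    by (rule derivative_eq_intros refl)+ (use assms in \<open>auto simp: power_0_left\<close>)
  then have "((\<lambda>t. complex_of_real ((t - t0) ^ r / fact r)) has_vector_derivative
      complex_of_real (if r = 1 then 1 else 0)) (at t0)"
    by (intro has_vector_derivative_of_real)
       (simp add: has_real_derivative_iff_has_vector_derivative)
  with assms show "((\<lambda>t. alpha_bar \<omega> t t0 (replicate r 0)) has_vector_derivative
      (if r = 1 then 1 else 0)) (at t0)"
    by (simp add: alpha_bar_def if_distrib cong: if_cong)
qed

lemma beta_bar_nonzero_letter:
  assumes "k \<noteq> 0"
  shows "beta_bar \<omega> t0 [k] = 0"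
  by (rule beta_bar_eqI) (simp add: alpha_bar_def assms)

theorem theorem6:
  fixes \<omega> :: "real ^ 'd" and t0 :: real and r :: nat
    and k l :: "int ^ 'd" and ls :: "(int ^ 'd) list"
  assumes "nonresonant \<omega>" and "r \<ge> 1" and "k \<noteq> 0"
  shows "beta_bar \<omega> t0 [k] = 0 \<and>
    beta_bar \<omega> t0 [0] = 1 \<and>
    beta_bar \<omega> t0 (replicate (r + 1) 0) = 0 \<and>
    beta_bar \<omega> t0 (replicate r 0 @ [k]) =
      \<i> / of_real (k \<odot> \<omega>) *
        (beta_bar \<omega> t0 (replicate (r - 1) 0 @ [k])
         - beta_bar \<omega> t0 (replicate r 0) * exp (\<i> * of_real (k \<odot> \<omega> * t0))) \<and>
    beta_bar \<omega> t0 (k # l # ls) =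
      \<i> / of_real (k \<odot> \<omega>) *
        (exp (\<i> * of_real (k \<odot> \<omega> * t0)) * beta_bar \<omega> t0 (l # ls)
         - beta_bar \<omega> t0 ((k + l) # ls)) \<and>
    beta_bar \<omega> t0 (replicate r 0 @ k # l # ls) =
      \<i> / of_real (k \<odot> \<omega>) *
        (beta_bar \<omega> t0 (replicate (r - 1) 0 @ k # l # ls)
         - beta_bar \<omega> t0 (replicate r 0 @ (k + l) # ls))"
proof (intro conjI)
  show "beta_bar \<omega> t0 [k] = 0"
    using \<open>k \<noteq> 0\<close> by (rule beta_bar_nonzero_letter)
  show "beta_bar \<omega> t0 [0] = 1"
    using beta_bar_replicate_zero[of 1 \<omega> t0] by simp
  show "beta_bar \<omega> t0 (replicate (r + 1) 0) = 0"
    using beta_bar_replicate_zero[of "r + 1" \<omega> t0] \<open>r \<ge> 1\<close> by simp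
  show "beta_bar \<omega> t0 (replicate r 0 @ [k]) =
      \<i> / of_real (k \<odot> \<omega>) *
        (beta_bar \<omega> t0 (replicate (r - 1) 0 @ [k])
         - beta_bar \<omega> t0 (replicate r 0) * exp (\<i> * of_real (k \<odot> \<omega> * t0)))"
    by (rule beta_bar_lincomb[where a = 1, simplified])
       (simp add: alpha_bar_def Gam.simps(4)[OF assms(2,3)] ldot_scaleR)
  show "beta_bar \<omega> t0 (k # l # ls) =
      \<i> / of_real (k \<odot> \<omega>) *
        (exp (\<i> * of_real (k \<odot> \<omega> * t0)) * beta_bar \<omega> t0 (l # ls)
         - beta_bar \<omega> t0 ((k + l) # ls))"
    by (rule beta_bar_lincomb[where b = 1, simplified])
       (simp add: alpha_bar_def Gam.simps(5)[OF assms(3)] ldot_scaleR)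
  show "beta_bar \<omega> t0 (replicate r 0 @ k # l # ls) =
      \<i> / of_real (k \<odot> \<omega>) *
        (beta_bar \<omega> t0 (replicate (r - 1) 0 @ k # l # ls)
         - beta_bar \<omega> t0 (replicate r 0 @ (k + l) # ls))"
    by (rule beta_bar_lincomb[where a = 1 and b = 1, simplified])
       (simp add: alpha_bar_def Gam.simps(6)[OF assms(2,3)])
qed

end
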